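(* Let $l$, $n$ and $d\geqslant n$ be positive integers. Then every word over an ordered alphabet of cardinality $l$ whose length is not less than $\Psi(n,d,l)$ either contains a subword of the form $x^d$ with $x$ a nonempty word, or is $n$-divisible. Here $$\Psi(n,d,l) = 256\, l\,(nd)^{2\log_2 (nd)+10}\,d^2.$$
   Context: The alphabet $a_1\prec a_2\prec\dots\prec a_l$ is linearly ordered, and words are compared lexicographically; two words are incomparable if one of them is a beginning (prefix) of the other. Thus $u\succ v$ means that neither word is a prefix of the other and, at the first position where they differ, the letter of $u$ is greater than that of $v$. Subwords are blocks of consecutive letters. A word $W$ is $n$-divisible if it can be represented as a concatenation $W=vu_1u_2\cdots u_n$ with $u_1\succ u_2\succ\dots\succ u_n$. *)

theory Defs
  imports Complex_Main "HOL-Library.Sublist"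
begin

text \<open>
  The library's \<^const>\<open>lexord\<close> makes a proper prefix smaller than the whole word.
  Here words one of which is a prefix of the other (in particular equal words) are
  incomparable, so these pairs are excluded by \<open>u \<parallel> v\<close>.
\<close>

definition word_gr :: "'a::linorder list \<Rightarrow> 'a list \<Rightarrow> bool"  (infix \<open>\<succ>\<close> 50)
  where "u \<succ> v \<longleftrightarrow> u \<parallel> v \<and> (v, u) \<in> lexord {(a, b). a < b}"

lemma word_gr_iff:
  "u \<succ> v \<longleftrightarrow> (\<exists>p a b s t. u = p @ a # s \<and> v = p @ b # t \<and> b < a)"
proof
  assume "u \<succ> v"
  then have "\<not> prefix v u" "(v, u) \<in> lexord {(a, b). a < b}"
    by (auto simp: word_gr_def)
  then show "\<exists>p a b s t. u = p @ a # s \<and> v = p @ b # t \<and> b < a"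
    unfolding lexord_def by (auto simp: prefix_def)
next
  assume "\<exists>p a b s t. u = p @ a # s \<and> v = p @ b # t \<and> b < a"
  then obtain p a b s t where *: "u = p @ a # s" "v = p @ b # t" "b < a"
    by blast
  then have "(v, u) \<in> lexord {(a, b). a < b}"
    by (simp add: lexord_append_leftI)
  moreover have "u \<parallel> v"
    using * by (auto simp: parallel_def)
  ultimately show "u \<succ> v"
    by (simp add: word_gr_def)
qed

text \<open>
  The factors are not required to be nonempty: for \<open>n \<ge> 2\<close> this is automatic, since
  the empty word is a prefix of every word.
\<close>

definition n_divisible :: "nat \<Rightarrow> 'a::linorder list \<Rightarrow> bool"
  where "n_divisible n W \<longleftrightarrow>
    (\<exists>v us. W = v @ concat us \<and> length us = n \<and> successively (\<succ>) us)"

definition word_power :: "'a list \<Rightarrow> nat \<Rightarrow> 'a list"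
  where "word_power x d = concat (replicate d x)"

definition Psi :: "nat \<Rightarrow> nat \<Rightarrow> nat \<Rightarrow> real"
  where "Psi n d l =
    256 * real l * real (n * d) powr (2 * log 2 (real (n * d)) + 10) * real d ^ 2"

end

theory Submission
  imports Defs
begin

text \<open>
  The proof counts the distinct factors of a fixed length that occur in a long piece of
  \<open>W\<close>.  Suppose that \<open>W\<close> is not \<open>n\<close>-divisible.

  Cut a piece of \<open>W\<close> into consecutive blocks, and let \<open>s\<close> bound the number of distinct
  factors of length \<open>a\<close> that occur in the blocks.  If there are more than \<open>(n - 1) s\<close>
  blocks, some block contains fewer than \<open>n\<close> distinct factors of length \<open>a\<close>
  (\<open>block_with_few_factors\<close>).  To see this, let the rank of a factor \<open>w\<close> of a block be the
  largest \<open>k\<close> such that the text before the block ends in \<open>k\<close> consecutive words decreasing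
  towards \<open>w\<close>, the last one being greater than \<open>w\<close>.  There are only \<open>n - 1\<close> possible ranks,
  so in a block with \<open>n\<close> or more distinct factors two of them have the same rank; let
  \<open>w\<close> be the smaller one.  If the same \<open>w\<close> is chosen in a later block, its rank there is
  larger, because the greater factor of the earlier block prolongs the decreasing sequence.
  Hence the pair of \<open>w\<close> and its rank determines the block, and there are at most
  \<open>(n - 1) s\<close> such pairs.

  A word with fewer than \<open>n\<close> factors of length \<open>a\<close> has at most \<open>(n - 1)\<^sup>2\<close> factors of
  length \<open>2 a\<close>, so cutting it into \<open>n ^ 3\<close> blocks produces a block with fewer than \<open>n\<close>
  factors of length \<open>2 a\<close>.  Cutting \<open>W\<close> into \<open>n l\<close> blocks yields one with fewer than \<open>n\<close>
  distinct letters; then doubling \<open>K\<close> times, where \<open>2 ^ K \<ge> n d\<close>, gives a word \<open>U\<close> with fewer than \<open>n\<close>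
  factors of length \<open>2 ^ K\<close> (\<open>iterated_doubling\<close>).  Two of the first \<open>n\<close> positions of \<open>U\<close>
  then start the same factor.  Two occurrences, at distance \<open>p < n\<close>, of a word of length
  at least \<open>n d\<close> together contain the \<open>d\<close>-th power of its prefix of length \<open>p\<close>
  (\<open>power_of_few_factors\<close>).

  The length consumed is \<open>n l (n ^ 3) ^ K (2 ^ K + n)\<close>.  Since \<open>d \<ge> n\<close>, we have
  \<open>n ^ 3 \<le> (n d)\<^sup>2\<close>, and with \<open>K \<le> log 2 (n d) + 1\<close> this is below \<open>Psi n d l\<close>.
\<close>

section \<open>Decreasing sequences of words\<close>

text \<open>
  The order is decided at the first difference, so it persists whatever follows.  This
  allows the gaps between selected factors to be absorbed into the factors.
\<close>

lemma word_gr_append: "u \<succ> v \<Longrightarrow> u @ x \<succ> v @ y"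
  unfolding word_gr_iff by fastforce

lemma word_gr_total:
  assumes "length u = length v" "u \<noteq> v"
  shows "u \<succ> v \<or> v \<succ> u"
proof -
  have "u \<parallel> v"
    using assms by (rule not_equal_is_parallel[rotated])
  from parallel_decomp[OF this] obtain p a s b t
    where "a \<noteq> b" "u = p @ a # s" "v = p @ b # t" by blast
  then show ?thesis
    unfolding word_gr_iff by (cases a b rule: linorder_cases) blast+
qed

lemma successively_gr_extend:
  assumes "successively (\<succ>) (us @ u # vs)"
  shows "successively (\<succ>) (us @ (u @ q) # vs)"
  using assms word_gr_append[of _ _ "[]" q] word_gr_append[of u _ q "[]"]
  by (auto simp: successively_append_iff successively_Cons)

lemma n_divisible_sublist:
  assumes "n_divisible n U" "sublist U W" "n > 0"
  shows "n_divisible n W"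
proof -
  obtain v us where U: "U = v @ concat us" "length us = n" "successively (\<succ>) us"
    using assms(1) unfolding n_divisible_def by blast
  obtain p q where W: "W = p @ U @ q"
    using assms(2) unfolding sublist_def by blast
  obtain us' u where us: "us = us' @ [u]"
    using U(2) assms(3) by (cases us rule: rev_cases) auto
  let ?us = "us' @ [u @ q]"
  have "W = (p @ v) @ concat ?us"
    by (simp add: W U(1) us)
  moreover have "length ?us = n"
    using U(2) us by simp
  moreover have "successively (\<succ>) ?us"
    using successively_gr_extend[of us' u "[]" q] U(3) us by simp
  ultimately show ?thesis
    unfolding n_divisible_def by blast
qed

text \<open>Surplus words at the start of the sequence can be moved into the unconstrained beginning.\<close>

lemma n_divisible_antimono:
  assumes "n_divisible k W" "n \<le> k"
  shows "n_divisible n W"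
proof -
  obtain v us where W: "W = v @ concat us" "length us = k" "successively (\<succ>) us"
    using assms(1) unfolding n_divisible_def by blast
  define xs ys where "xs = take (k - n) us" and "ys = drop (k - n) us"
  have us: "us = xs @ ys" by (simp add: xs_def ys_def)
  have "W = (v @ concat xs) @ concat ys"
    by (simp add: W(1) us)
  moreover have "length ys = n"
    using W(2) assms(2) by (simp add: ys_def)
  moreover have "successively (\<succ>) ys"
    using W(3) by (simp add: us successively_append_iff)
  ultimately show ?thesis
    unfolding n_divisible_def by blast
qed

text \<open>
  The state of a decreasing sequence under construction: \<open>P\<close> is the text read so far, and
  a later occurrence of \<open>w\<close> can serve as the next term.
\<close>

definition divisible_above :: "nat \<Rightarrow> 'a::linorder list \<Rightarrow> 'a list \<Rightarrow> bool"
  where "divisible_above k P w \<longleftrightarrow>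
    (\<exists>v us. P = v @ concat us \<and> length us = k \<and> successively (\<succ>) (us @ [w]))"

lemma divisible_above_0: "divisible_above 0 P w"
  unfolding divisible_above_def by (intro exI[of _ P] exI[of _ "[]"]) simp

text \<open>
  The last word of the sequence absorbs the added text, so the next term need not follow
  immediately.
\<close>

lemma divisible_above_append:
  assumes "divisible_above k P w"
  shows "divisible_above k (P @ q) w"
proof (cases k)
  case 0
  then show ?thesis by (simp add: divisible_above_0)
next
  case (Suc j)
  obtain v us where P: "P = v @ concat us" "length us = k" "successively (\<succ>) (us @ [w])"
    using assms unfolding divisible_above_def by blast
  then obtain us' u where us: "us = us' @ [u]"
    using Suc by (cases us rule: rev_cases) auto
  let ?us = "us' @ [u @ q]"
  have "P @ q = v @ concat ?us" "length ?us = k"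
    using P(1,2) us by simp_all
  moreover have "successively (\<succ>) (?us @ [w])"
    using P(3) us successively_gr_extend[of us' u "[w]" q] by simp
  ultimately show ?thesis
    unfolding divisible_above_def by blast
qed

lemma divisible_above_Suc:
  assumes "divisible_above k P w" "sublist w B" "w \<succ> w'"
  shows "divisible_above (Suc k) (P @ B) w'"
proof -
  obtain p q where B: "B = p @ w @ q"
    using assms(2) unfolding sublist_def by blast
  obtain v us where P: "P @ p = v @ concat us" "length us = k" "successively (\<succ>) (us @ [w])"
    using divisible_above_append[OF assms(1)] unfolding divisible_above_def by blast
  let ?us = "us @ [w @ q]"
  have "P @ B = v @ concat ?us" "length ?us = Suc k"
    using P(1,2) B by (simp_all flip: append_assoc)
  moreover have "successively (\<succ>) (?us @ [w'])"
    using successively_gr_extend[of us w "[w']" q] P(3) assms(3)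
    by (auto simp: successively_append_iff)
  ultimately show ?thesis
    unfolding divisible_above_def by blast
qed

lemma divisible_above_n_divisible:
  assumes "divisible_above k P w" "sublist w B"
  shows "n_divisible (Suc k) (P @ B)"
proof -
  obtain p q where B: "B = p @ w @ q"
    using assms(2) unfolding sublist_def by blast
  obtain v us where P: "P @ p = v @ concat us" "length us = k" "successively (\<succ>) (us @ [w])"
    using divisible_above_append[OF assms(1)] unfolding divisible_above_def by blast
  let ?us = "us @ [w @ q]"
  have "P @ B = v @ concat ?us" "length ?us = Suc k"
    using P(1,2) B by (simp_all flip: append_assoc)
  moreover have "successively (\<succ>) ?us"
    using successively_gr_extend[of us w "[]" q] P(3) by simp
  ultimately show ?thesis
    unfolding n_divisible_def by blast
qed


section \<open>Factors of a fixed length\<close>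

definition factors :: "nat \<Rightarrow> 'a list \<Rightarrow> 'a list set"
  where "factors a W = {u. sublist u W \<and> length u = a}"

lemma finite_factors [simp]: "finite (factors a W)"
  by (rule finite_subset[of _ "set (sublists W)"]) (auto simp: factors_def)

lemma factors_mono: "sublist U W \<Longrightarrow> factors a U \<subseteq> factors a W"
  by (auto simp: factors_def intro: sublist_order.order_trans)

text \<open>A factor is determined by its two halves.\<close>

lemma card_factors_double: "card (factors (2 * a) W) \<le> card (factors a W) ^ 2"
proof -
  let ?f = "\<lambda>u. (take a u, drop a u)"
  have "inj_on ?f (factors (2 * a) W)"
    by (rule inj_on_inverseI[where g = "\<lambda>(x, y). x @ y"]) simp
  moreover have "?f ` factors (2 * a) W \<subseteq> factors a W \<times> factors a W"
  proof
    fix y assume "y \<in> ?f ` factors (2 * a) W"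
    then obtain u where u: "sublist u W" "length u = 2 * a" "y = ?f u"
      by (auto simp: factors_def)
    have "sublist (take a u) W" "sublist (drop a u) W"
      using sublist_order.order_trans[OF _ u(1)] by simp_all
    then show "y \<in> factors a W \<times> factors a W"
      using u(2,3) by (simp add: factors_def)
  qed
  ultimately have "card (factors (2 * a) W) \<le> card (factors a W \<times> factors a W)"
    by (intro card_inj_on_le) auto
  then show ?thesis
    by (simp add: card_cartesian_product power2_eq_square)
qed

lemma concat_nth_split:
  assumes "i < j" "j \<le> length Bs"
  shows "\<exists>R. concat (take j Bs) = (concat (take i Bs) @ Bs ! i) @ R"
proof -
  have "take j Bs = take i Bs @ Bs ! i # drop (Suc i) (take j Bs)"
    using assms id_take_nth_drop[of i "take j Bs"] by simp
  then have "concat (take j Bs) = concat (take i Bs @ Bs ! i # drop (Suc i) (take j Bs))"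
    by (rule arg_cong)
  then show ?thesis by auto
qed

text \<open>
  The central pigeonhole argument.  Blocks with at least \<open>n\<close> factors inject into the pairs of
  a rank below \<open>n - 1\<close> and a word of \<open>S\<close>.
\<close>

lemma block_with_few_factors:
  assumes ndiv: "\<not> n_divisible n (concat Bs)"
    and n: "n > 0"
    and S: "finite S" "\<And>B. B \<in> set Bs \<Longrightarrow> factors a B \<subseteq> S"
    and len: "(n - 1) * card S < length Bs"
  shows "\<exists>B \<in> set Bs. card (factors a B) < n"
proof (rule ccontr)
  assume "\<not> ?thesis"
  then have many: "n \<le> card (factors a (Bs ! t))" if "t < length Bs" for t
    using that by (meson not_less nth_mem)
  define P where "P t = concat (take t Bs)" for t
  define rank where "rank t w = Max {k. divisible_above k (P t) w}" for t w
  \<comment> \<open>A sequence of \<open>n - 1\<close> words above \<open>w\<close>, followed by \<open>w\<close> itself, would have \<open>n\<close> terms.\<close>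
  have bound: "k < n - 1"
    if "divisible_above k (P t) w" "w \<in> factors a (Bs ! t)" "t < length Bs" for k t w
  proof (rule ccontr)
    assume "\<not> k < n - 1"
    then have "n \<le> Suc k" by simp
    have "sublist w (Bs ! t)" using that by (simp add: factors_def)
    from divisible_above_n_divisible[OF that(1) this]
    have "n_divisible n (P t @ Bs ! t)"
      using \<open>n \<le> Suc k\<close> by (rule n_divisible_antimono)
    moreover have "sublist (P t @ Bs ! t) (concat Bs)"
      using concat_nth_split[of t "length Bs" Bs] that(3)
      by (force simp: P_def sublist_def)
    ultimately show False
      using ndiv n n_divisible_sublist by blast
  qed
  have rank: "divisible_above (rank t w) (P t) w" "rank t w < n - 1"
    and rank_ge: "\<And>k. divisible_above k (P t) w \<Longrightarrow> k \<le> rank t w"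
    if "w \<in> factors a (Bs ! t)" "t < length Bs" for t w
  proof -
    let ?K = "{k. divisible_above k (P t) w}"
    have fin: "finite ?K"
      by (rule finite_subset[of _ "{..<n - 1}"]) (use bound that in auto)
    have "?K \<noteq> {}" using divisible_above_0 by blast
    from Max_in[OF fin this] show 1: "divisible_above (rank t w) (P t) w"
      by (simp add: rank_def)
    show "rank t w < n - 1" by (rule bound[OF 1 that])
    show "\<And>k. divisible_above k (P t) w \<Longrightarrow> k \<le> rank t w"
      using fin by (simp add: rank_def)
  qed
  \<comment> \<open>A block has \<open>n\<close> factors but only \<open>n - 1\<close> ranks; factors of equal length are comparable.\<close>
  have pair: "\<exists>w w'. w \<in> factors a (Bs ! t) \<and> w' \<in> factors a (Bs ! t) \<and> w' \<succ> w
      \<and> rank t w' = rank t w" if t: "t < length Bs" for t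
  proof -
    have "rank t ` factors a (Bs ! t) \<subseteq> {..<n - 1}"
      using rank(2) t by blast
    then have "card (rank t ` factors a (Bs ! t)) \<le> n - 1"
      using card_mono[of "{..<n - 1}"] by simp
    then have "\<not> inj_on (rank t) (factors a (Bs ! t))"
      using many[OF t] n card_image by fastforce
    then obtain u v where uv: "u \<in> factors a (Bs ! t)" "v \<in> factors a (Bs ! t)" "u \<noteq> v"
      "rank t u = rank t v" unfolding inj_on_def by blast
    moreover have "length u = length v" using uv by (simp add: factors_def)
    ultimately show ?thesis using word_gr_total by metis
  qed
  then have "\<forall>t. \<exists>w. t < length Bs \<longrightarrow> (\<exists>w'. w \<in> factors a (Bs ! t) \<and> w' \<in> factors a (Bs ! t)
      \<and> w' \<succ> w \<and> rank t w' = rank t w)"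
    by blast
  from choice[OF this] obtain lo where lo: "\<And>t. t < length Bs \<Longrightarrow>
      \<exists>w'. lo t \<in> factors a (Bs ! t) \<and> w' \<in> factors a (Bs ! t)
        \<and> w' \<succ> lo t \<and> rank t w' = rank t (lo t)"
    by blast
  let ?f = "\<lambda>t. (rank t (lo t), lo t)"
  \<comment> \<open>If the same \<open>w\<close> is chosen in block \<open>s\<close> and later in block \<open>t\<close>, the greater word of equal
    rank in block \<open>s\<close> prolongs its own sequence, which raises the rank of \<open>w\<close> in block \<open>t\<close>.\<close>
  have neq: "?f s \<noteq> ?f t" if less: "s < t" "t < length Bs" for s t
  proof
    assume eq: "?f s = ?f t"
    have len_s: "s < length Bs" using that by simp
    obtain hi where hi: "hi \<in> factors a (Bs ! s)" "hi \<succ> lo s" "rank s hi = rank s (lo s)"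
      using lo[OF len_s] by blast
    have "divisible_above (rank s hi) (P s) hi"
      using hi(1) len_s by (rule rank(1))
    moreover have "sublist hi (Bs ! s)"
      using hi(1) by (simp add: factors_def)
    moreover have "hi \<succ> lo t"
      using hi(2) eq by simp
    ultimately have "divisible_above (Suc (rank s hi)) (P s @ Bs ! s) (lo t)"
      by (rule divisible_above_Suc)
    moreover obtain R where "P t = (P s @ Bs ! s) @ R"
      using concat_nth_split[OF less(1) less_imp_le[OF less(2)]] unfolding P_def by blast
    ultimately have "divisible_above (Suc (rank s hi)) (P t) (lo t)"
      using divisible_above_append by metis
    moreover have "lo t \<in> factors a (Bs ! t)"
      using lo[OF less(2)] by blast
    ultimately have "Suc (rank s hi) \<le> rank t (lo t)"
      using less(2) by (intro rank_ge)
    then show False using eq hi(3) by simp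
  qed
  have "inj_on ?f {..<length Bs}"
    by (rule linorder_inj_onI) (use neq in auto)
  moreover have "?f ` {..<length Bs} \<subseteq> {..<n - 1} \<times> S"
  proof
    fix y assume "y \<in> ?f ` {..<length Bs}"
    then obtain t where t: "t < length Bs" "y = ?f t" by blast
    then have "lo t \<in> factors a (Bs ! t)" using lo by blast
    then show "y \<in> {..<n - 1} \<times> S"
      using t rank(2) S(2)[OF nth_mem] by blast
  qed
  ultimately have "card {..<length Bs} \<le> card ({..<n - 1} \<times> S)"
    using S(1) by (intro card_inj_on_le) auto
  then show False
    using len by (simp add: card_cartesian_product)
qed


section \<open>Passing to longer factors\<close>

lemma split_into_blocks:
  assumes "N * c \<le> length W"
  shows "\<exists>Bs. length Bs = N \<and> (\<forall>B \<in> set Bs. length B = c) \<and> prefix (concat Bs) W"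
  using assms
proof (induction N arbitrary: W)
  case 0
  then show ?case by simp
next
  case (Suc N)
  then have "N * c \<le> length (drop c W)"
    by simp
  from Suc.IH[OF this] obtain Bs where Bs: "length Bs = N" "\<forall>B \<in> set Bs. length B = c"
    "prefix (concat Bs) (drop c W)"
    by blast
  have "prefix (concat (take c W # Bs)) (take c W @ drop c W)"
    using Bs(3) by (simp del: append_take_drop_id)
  then show ?case
    using Bs Suc.prems by (intro exI[of _ "take c W # Bs"]) simp
qed

lemma factor_with_few_factors:
  assumes "\<not> n_divisible n W" "n > 0" "(n - 1) * card (factors a W) < N" "N * c \<le> length W"
  shows "\<exists>U. sublist U W \<and> length U = c \<and> card (factors a U) < n"
proof -
  obtain Bs where Bs: "length Bs = N" "\<forall>B \<in> set Bs. length B = c" "prefix (concat Bs) W"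
    using split_into_blocks[OF assms(4)] by blast
  have sub: "sublist (concat Bs) W"
    using Bs(3) by (rule prefix_imp_sublist)
  have sub_block: "sublist B W" if B: "B \<in> set Bs" for B
  proof -
    obtain xs ys where "Bs = xs @ B # ys" using split_list[OF B] by blast
    then have "sublist B (concat Bs)" by (auto simp: sublist_def)
    then show ?thesis using sub by (rule sublist_order.order_trans)
  qed
  have "\<exists>B \<in> set Bs. card (factors a B) < n"
  proof (rule block_with_few_factors)
    show "\<not> n_divisible n (concat Bs)"
      using assms(1,2) sub n_divisible_sublist by blast
    show "factors a B \<subseteq> factors a W" if "B \<in> set Bs" for B
      using sub_block[OF that] by (rule factors_mono)
  qed (use assms Bs in auto)
  then show ?thesis using sub_block Bs(2) by blast
qed

text \<open>
  The loss of a factor \<open>n ^ 3\<close> per doubling comes from \<open>block_with_few_factors\<close>: at most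
  \<open>(n - 1)\<^sup>2\<close> factors have the doubled length, so more than \<open>(n - 1) ^ 3\<close> blocks are needed.
\<close>

lemma iterated_doubling:
  assumes "\<not> n_divisible n W" "n > 0" "card (factors a W) < n" "(n ^ 3) ^ K * c \<le> length W"
  shows "\<exists>U. sublist U W \<and> c \<le> length U \<and> card (factors (2 ^ K * a) U) < n"
  using assms
proof (induction K arbitrary: a W)
  case 0
  then show ?case by auto
next
  case (Suc K)
  have "(n - 1) * card (factors (2 * a) W) \<le> (n - 1) * (n - 1) ^ 2"
  proof (rule mult_le_mono2)
    have "card (factors (2 * a) W) \<le> card (factors a W) ^ 2"
      by (rule card_factors_double)
    also have "\<dots> \<le> (n - 1) ^ 2"
      using Suc.prems(3) by (intro power_mono) auto
    finally show "card (factors (2 * a) W) \<le> (n - 1) ^ 2" .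
  qed
  also have "\<dots> = (n - 1) ^ 3"
    by (simp add: power2_eq_square power3_eq_cube)
  also have "\<dots> < n ^ 3"
    using \<open>n > 0\<close> by (intro power_strict_mono) auto
  finally have "\<exists>V. sublist V W \<and> length V = (n ^ 3) ^ K * c \<and> card (factors (2 * a) V) < n"
    using Suc.prems by (intro factor_with_few_factors[where N = "n ^ 3"]) (auto simp: mult.assoc)
  then obtain V where V: "sublist V W" "length V = (n ^ 3) ^ K * c" "card (factors (2 * a) V) < n"
    by blast
  have "\<not> n_divisible n V"
    using V(1) Suc.prems(1,2) n_divisible_sublist by blast
  then obtain U where "sublist U V" "c \<le> length U" "card (factors (2 ^ K * (2 * a)) U) < n"
    using Suc.IH[of V "2 * a"] V Suc.prems(2) by auto
  then show ?case
    using V(1) by (intro exI[of _ U]) (auto simp: ac_simps intro: sublist_order.order_trans)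
qed


section \<open>Powers\<close>

text \<open>
  The hypothesis says that \<open>X @ Y\<close> has period \<open>length X\<close>: each power of \<open>X\<close> that fits into
  \<open>Y\<close> is a prefix of \<open>Y\<close>, and putting \<open>X\<close> in front gives the next power.
\<close>

lemma word_power_prefix:
  assumes "prefix Y (X @ Y)" "e * length X \<le> length X + length Y"
  shows "prefix (word_power X e) (X @ Y)"
  using assms(2)
proof (induction e)
  case 0
  then show ?case by (simp add: word_power_def)
next
  case (Suc e)
  have "prefix (word_power X e) (X @ Y)"
    using Suc by simp
  moreover have "length (word_power X e) \<le> length Y"
    using Suc.prems by (simp add: word_power_def length_concat sum_list_replicate)
  ultimately have "prefix (word_power X e) Y"
    using assms(1) prefix_length_prefix by blast
  then show ?case by (simp add: word_power_def)
qed

text \<open>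
  The first \<open>n\<close> positions cannot all start different factors, and a factor repeated at a
  distance below \<open>n\<close> overlaps itself so much that the two occurrences cover a \<open>d\<close>-th power.
\<close>

lemma power_of_few_factors:
  assumes "card (factors a U) < n" "n * d \<le> a" "a + n \<le> length U"
  shows "\<exists>x. x \<noteq> [] \<and> sublist (word_power x d) U"
proof -
  let ?w = "\<lambda>i. take a (drop i U)"
  have "?w ` {..<n} \<subseteq> factors a U"
  proof -
    have "sublist (?w i) U" for i
      by (rule sublist_order.order_trans[OF sublist_take sublist_drop])
    then show ?thesis using assms(3) by (auto simp: factors_def)
  qed
  then have "card (?w ` {..<n}) \<le> card (factors a U)"
    by (intro card_mono) auto
  then have "\<not> inj_on ?w {..<n}"
    using assms(1) card_image by fastforce
  then obtain i j where ij: "i < j" "j < n" "?w i = ?w j"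
    unfolding inj_on_def by (metis lessThan_iff linorder_neqE)
  \<comment> \<open>\<open>Y\<close> starts both at \<open>i\<close> and, after \<open>X\<close>, at \<open>j\<close>; hence \<open>X @ Y\<close> also begins with \<open>Y\<close>.\<close>
  define X Y where "X = take (j - i) (drop i U)" and "Y = ?w j"
  have len: "length X = j - i" "length Y = a"
    using ij assms(3) by (auto simp: X_def Y_def)
  have XY: "X @ Y = take (j - i + a) (drop i U)"
    unfolding X_def Y_def take_add using ij(1) by simp
  have "Y = take a (X @ Y)"
    unfolding XY using ij(3) by (simp add: Y_def)
  then have "prefix Y (X @ Y)"
    by (metis take_is_prefix)
  moreover have "d * length X \<le> length X + length Y"
  proof -
    have "d * (j - i) \<le> d * n" using ij by (intro mult_le_mono2) simp
    also have "\<dots> \<le> a" using assms(2) by (simp add: mult.commute)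
    finally show ?thesis by (simp add: len)
  qed
  ultimately have "prefix (word_power X d) (X @ Y)"
    by (rule word_power_prefix)
  moreover have "sublist (X @ Y) U"
    unfolding XY by (rule sublist_order.order_trans[OF sublist_take sublist_drop])
  ultimately have "sublist (word_power X d) U"
    by (rule sublist_order.order_trans[OF prefix_imp_sublist])
  moreover have "X \<noteq> []" using len(1) ij(1) by auto
  ultimately show ?thesis by blast
qed


section \<open>The bound\<close>

lemma power_or_n_divisible:
  fixes A :: "'a::linorder set" and W :: "'a list"
  assumes "n > 0" "finite A" "card A > 0" "W \<in> lists A" "n * d \<le> 2 ^ K"
    and len: "n * card A * ((n ^ 3) ^ K * (2 ^ K + n)) \<le> length W"
  shows "(\<exists>x. x \<noteq> [] \<and> sublist (word_power x d) W) \<or> n_divisible n W"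
proof (rule disjCI)
  assume ndiv: "\<not> n_divisible n W"
  have "factors 1 W \<subseteq> (\<lambda>x. [x]) ` A"
    using assms(4) by (auto simp: factors_def length_Suc_conv dest: set_mono_sublist)
  then have "card (factors 1 W) \<le> card A"
    using assms(2) by (rule surj_card_le[rotated])
  then have "(n - 1) * card (factors 1 W) \<le> (n - 1) * card A"
    by (rule mult_le_mono2)
  also have "\<dots> < n * card A"
    using assms(1,3) by simp
  finally obtain V where V: "sublist V W" "length V = (n ^ 3) ^ K * (2 ^ K + n)"
    "card (factors 1 V) < n"
    using factor_with_few_factors[OF ndiv assms(1) _ len] by blast
  have "\<not> n_divisible n V"
    using V(1) ndiv assms(1) n_divisible_sublist by blast
  then obtain U where U: "sublist U V" "2 ^ K + n \<le> length U" "card (factors (2 ^ K * 1) U) < n"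
    using iterated_doubling[of n V 1 K "2 ^ K + n"] V assms(1) by auto
  obtain x where "x \<noteq> []" "sublist (word_power x d) U"
    using power_of_few_factors[of "2 ^ K" U n d] U assms(5) by auto
  then show "\<exists>x. x \<noteq> [] \<and> sublist (word_power x d) W"
    using sublist_order.order_trans[OF _ sublist_order.order_trans[OF U(1) V(1)]] by blast
qed

text \<open>
  The least \<open>K\<close> with \<open>n d \<le> 2 ^ K\<close> works; being the least, it satisfies \<open>2 ^ K \<le> 2 n d\<close>.
\<close>

lemma Psi_ge:
  assumes "n > 0" "d \<ge> n"
  shows "\<exists>K. n * d \<le> 2 ^ K \<and> real (n * l * ((n ^ 3) ^ K * (2 ^ K + n))) \<le> Psi n d l"
proof -
  define m where "m = n * d"
  define K where "K = nat \<lceil>log 2 m\<rceil>"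
  have m: "m \<ge> 1" "n \<le> m" "d \<ge> 1" "n ^ 2 \<le> m"
    using assms by (auto simp: m_def power2_eq_square)
  have "log 2 m \<ge> 0" using m by simp
  then have K: "log 2 m \<le> K" "K \<le> log 2 m + 1"
    unfolding K_def by linarith+
  have "real m \<le> 2 powr K"
    using K(1) m(1) by (simp add: log_le_iff)
  then have mK: "m \<le> 2 ^ K"
    by (simp add: powr_realpow flip: of_nat_le_iff)
  have "2 powr K \<le> 2 powr (log 2 m + 1)"
    using K(2) by (intro powr_mono) auto
  also have "\<dots> = 2 * real m"
    using m(1) by (simp add: powr_add)
  finally have Km: "2 ^ K \<le> 2 * real m"
    by (simp add: powr_realpow)
  \<comment> \<open>Here \<open>d \<ge> n\<close> enters, through \<open>n\<^sup>2 \<le> m\<close>: each doubling costs at most \<open>m\<^sup>2\<close>, which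
    gives the \<open>2 * log 2 m\<close> in the exponent.\<close>
  have "n ^ 3 \<le> n ^ 4"
    using assms(1) by (intro power_increasing) auto
  also have "\<dots> = (n ^ 2) ^ 2" by simp
  also have "\<dots> \<le> m ^ 2" using m(4) by (rule power_mono) simp
  finally have "real ((n ^ 3) ^ K) \<le> real ((m ^ 2) ^ K)"
    by (simp only: of_nat_le_iff power_mono)
  also have "\<dots> = real m powr (2 * K)"
    using m(1) by (simp add: powr_realpow flip: power_mult of_nat_mult)
  also have "\<dots> \<le> real m powr (2 * log 2 m + 2)"
    using K(2) m(1) by (intro powr_mono) auto
  finally have nK: "real ((n ^ 3) ^ K) \<le> real m powr (2 * log 2 m + 2)" .
  have "real (2 ^ K + n) \<le> 3 * real m"
    using Km m(2) by simp
  with nK have prod: "real ((n ^ 3) ^ K) * real (2 ^ K + n)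
      \<le> real m powr (2 * log 2 m + 2) * (3 * real m)"
    by (rule mult_mono) simp_all
  have "real (n * l) \<le> real (m * l)"
    using m(2) by (simp only: of_nat_le_iff mult_le_mono1)
  then have "real (n * l) * (real ((n ^ 3) ^ K) * real (2 ^ K + n))
      \<le> real (m * l) * (real m powr (2 * log 2 m + 2) * (3 * real m))"
    using prod by (rule mult_mono) simp_all
  also have "\<dots> = 3 * real l * real m powr (2 * log 2 m + 4)"
  proof -
    have "real m powr (2 * log 2 m + 4) = real m powr ((2 * log 2 m + 2) + 2)"
      by (simp add: add.commute)
    also have "\<dots> = real m powr (2 * log 2 m + 2) * (real m * real m)"
      unfolding powr_add using m(1) by (simp add: power2_eq_square)
    finally show ?thesis by simp
  qed
  also have "\<dots> \<le> 256 * real l * real m powr (2 * log 2 m + 10)"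
    using m(1) by (intro mult_mono powr_mono) auto
  also have "\<dots> \<le> Psi n d l"
  proof -
    let ?b = "256 * real l * real m powr (2 * log 2 m + 10)"
    have "?b * 1 \<le> ?b * real d ^ 2"
      using m(3) by (intro mult_left_mono) simp_all
    then show ?thesis by (simp add: Psi_def m_def)
  qed
  finally have "real (n * l * ((n ^ 3) ^ K * (2 ^ K + n))) \<le> Psi n d l"
    by simp
  then show ?thesis
    using mK m_def by blast
qed

theorem theorem11:
  fixes l n d :: nat and A :: "'a::linorder set" and W :: "'a list"
  assumes "l > 0" and "n > 0" and "d \<ge> n"
    and "finite A" and "card A = l"
    and "W \<in> lists A"
    and "real (length W) \<ge> Psi n d l"
  shows "(\<exists>x. x \<noteq> [] \<and> sublist (word_power x d) W) \<or> n_divisible n W"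
proof -
  obtain K where K: "n * d \<le> 2 ^ K" "real (n * l * ((n ^ 3) ^ K * (2 ^ K + n))) \<le> Psi n d l"
    using Psi_ge[OF assms(2,3)] by blast
  have "n * l * ((n ^ 3) ^ K * (2 ^ K + n)) \<le> length W"
    using order_trans[OF K(2) assms(7)] by (simp only: of_nat_le_iff)
  then show ?thesis
    using power_or_n_divisible[of n A W d K] assms K(1) by simp
qed

end
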